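(* Let $F:X\to X$ be a nonsingular map with transfer operator $L$, and let $\mu=hm$ with $h\in B_s$ be an invariant probability measure of $F$. Let $\Phi:\mathbb N\to\mathbb R$ with $\lim_{n\to\infty}\Phi(n)=0$, and suppose that for each $f\in B_s$ such that $\int f\,dm=0$ and each $n\ge 0$ $$\|L^nf\|_w\le \Phi(n)\|f\|_{s}.$$ Then for each $\psi\in L^\infty$, $g\in B_s$ and $n\ge0$, $$\left|\int g\cdot(\psi\circ F^n)\,d\mu-\int\psi\,d\mu\int g\,d\mu\right|\le 2C\left[\|h\|_{s}+\|h\|_{s}^2\right]\Phi(n)\,\|\psi\|_\infty\,\|g\|_{s}.$$
   Context: $X$ is a manifold and $m$ is the normalized Lebesgue (probability) measure on $X$. A map is nonsingular if $m(F^{-1}(A))=0\iff m(A)=0$. The transfer operator $L$ sends the density $f$ of $f\,m$ to the density of the pushforward of $f\,m$ by $F$; it is positive, preserves integrals, and $\int g\,L(f)\,dm=\int (g\circ F)\,f\,dm$ for $f\in L^1,g\in L^\infty$. $L$ is assumed to act on two normed vector spaces $(B_s,\|\cdot\|_s)$, $(B_w,\|\cdot\|_w)$ with $B_s\subseteq B_w\subseteq L^1(m)$, satisfying: (i) $B_w$ contains the indicator functions of measurable sets; (ii) $B_s$ is closed under product and there is $C\ge1$ (the constant in the claim) with $\|fg\|_s\le C\|f\|_s\|g\|_s$ for all $f,g\in B_s$; (iii) $B_s$ is dense in $B_w$ for $\|\cdot\|_w$; (iv) $\|f\|_w\ge\int|f|\,dm$ for each $f\in B_w$, and $\|\cdot\|_s\ge\|\cdot\|_{L^\infty}$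 on $B_s$. *)

theory Defs
  imports "HOL-Probability.Probability"
begin

section \<open>Manifolds and their Lebesgue measures\<close>

text \<open>
  Charts take values in the closed orthant of a Euclidean space of positive dimension. This
  covers manifolds without boundary (small balls of Euclidean space can be translated into
  the interior of the orthant) as well as manifolds with boundary or corners such as the unit
  interval or the unit cube.
\<close>

definition orthant :: "'e::euclidean_space set" where
  "orthant = {y. \<forall>i\<in>Basis. 0 \<le> y \<bullet> i}"

definition is_chart :: "'a topology \<Rightarrow> 'a set \<Rightarrow> ('a \<Rightarrow> 'e::euclidean_space) \<Rightarrow> bool" where
  "is_chart X U \<phi> \<longleftrightarrow> openin X U \<and> openin (top_of_set orthant) (\<phi> ` U) \<and>
     homeomorphic_map (subtopology X U) (top_of_set (\<phi> ` U)) \<phi>"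

definition C1_on :: "'e::euclidean_space set \<Rightarrow> ('e \<Rightarrow> 'e) \<Rightarrow> bool" where
  "C1_on S \<tau> \<longleftrightarrow> (\<exists>D :: 'e \<Rightarrow> 'e \<Rightarrow>\<^sub>L 'e.
     continuous_on S D \<and> (\<forall>y\<in>S. (\<tau> has_derivative blinfun_apply (D y)) (at y within S)))"

definition is_manifold ::
  "'a topology \<Rightarrow> ('a set \<times> ('a \<Rightarrow> 'e::euclidean_space)) set \<Rightarrow> bool" where
  "is_manifold X \<A> \<longleftrightarrow> Hausdorff_space X \<and> second_countable X \<and>
     (\<forall>(U, \<phi>)\<in>\<A>. is_chart X U \<phi>) \<and> (\<Union>(fst ` \<A>)) = topspace X \<and>
     (\<forall>(U, \<phi>)\<in>\<A>. \<forall>(V, \<psi>)\<in>\<A>. C1_on (\<phi> ` (U \<inter> V)) (\<psi> \<circ> inv_into U \<phi>))"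

text \<open>
  A Lebesgue measure on a manifold is the volume of a continuous Riemannian metric: in every
  chart it has a positive continuous density with respect to Lebesgue measure (and every such
  measure is the volume of a metric, by rescaling any given metric conformally). Multiplying by
  a constant preserves this condition, so the normalized ones are those that are moreover
  probability measures.
\<close>

definition normalized_lebesgue ::
  "'a topology \<Rightarrow> ('a set \<times> ('a \<Rightarrow> 'e::euclidean_space)) set \<Rightarrow> 'a measure \<Rightarrow> bool" where
  "normalized_lebesgue X \<A> M \<longleftrightarrow> prob_space M \<and>
     space M = topspace X \<and> sets M = sigma_sets (topspace X) {U. openin X U} \<and>
     (\<forall>(U, \<phi>)\<in>\<A>. \<exists>\<rho> :: 'e \<Rightarrow> real.
        continuous_on (\<phi> ` U) \<rho> \<and> (\<forall>y\<in>\<phi> ` U. 0 < \<rho> y) \<and>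
        (\<forall>A\<in>sets M. A \<subseteq> U \<longrightarrow>
           emeasure M A = (\<integral>\<^sup>+ y. ennreal (\<rho> y) * indicator (\<phi> ` A) y \<partial>lborel)))"


section \<open>Nonsingular maps, transfer operators, invariant measures\<close>

definition nonsingular :: "'a measure \<Rightarrow> ('a \<Rightarrow> 'a) \<Rightarrow> bool" where
  "nonsingular M F \<longleftrightarrow> F \<in> measurable M M \<and>
     (\<forall>A\<in>sets M. emeasure M (F -` A \<inter> space M) = 0 \<longleftrightarrow> emeasure M A = 0)"

text \<open>
  The signed measure with density \<open>f\<close> is pushed forward by \<open>F\<close> to the signed measure assigning
  to \<open>A\<close> the integral of \<open>f\<close> over the preimage of \<open>A\<close>; \<open>L f\<close> is any version of its density.
\<close>

definition transfer_operator ::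
  "'a measure \<Rightarrow> ('a \<Rightarrow> 'a) \<Rightarrow> (('a \<Rightarrow> real) \<Rightarrow> 'a \<Rightarrow> real) \<Rightarrow> bool" where
  "transfer_operator M F L \<longleftrightarrow> (\<forall>f. integrable M f \<longrightarrow> integrable M (L f) \<and>
     (\<forall>A\<in>sets M. (LINT x:A|M. L f x) = (LINT x:(F -` A \<inter> space M)|M. f x)))"

definition invariant_prob :: "'a measure \<Rightarrow> ('a \<Rightarrow> 'a) \<Rightarrow> bool" where
  "invariant_prob \<mu> F \<longleftrightarrow> prob_space \<mu> \<and> F \<in> measurable \<mu> \<mu> \<and> distr \<mu> \<mu> F = \<mu>"


section \<open>Function spaces\<close>

text \<open>For functions that are not measurable the essential supremum is infinite by convention.\<close>

definition Linf_enorm :: "'a measure \<Rightarrow> ('a \<Rightarrow> real) \<Rightarrow> ereal" where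
  "Linf_enorm M f = esssup M (\<lambda>x. ereal \<bar>f x\<bar>)"

definition Linf :: "'a measure \<Rightarrow> ('a \<Rightarrow> real) set" where
  "Linf M = {f \<in> borel_measurable M. Linf_enorm M f < \<infinity>}"

definition Linf_norm :: "'a measure \<Rightarrow> ('a \<Rightarrow> real) \<Rightarrow> real" where
  "Linf_norm M f = real_of_ereal (Linf_enorm M f)"

text \<open>
  A normed subspace of \<open>L\<^sup>1\<close>, represented by the set \<open>B\<close> of all representatives of its elements
  and by a norm \<open>N\<close> on representatives; functions that agree almost everywhere are identified.
\<close>

definition normed_subspace_L1 ::
  "'a measure \<Rightarrow> ('a \<Rightarrow> real) set \<Rightarrow> (('a \<Rightarrow> real) \<Rightarrow> real) \<Rightarrow> bool" where
  "normed_subspace_L1 M B N \<longleftrightarrow>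
     (\<forall>f\<in>B. integrable M f) \<and>
     (\<forall>f\<in>B. \<forall>g\<in>borel_measurable M. (AE x in M. f x = g x) \<longrightarrow> g \<in> B \<and> N g = N f) \<and>
     (\<lambda>x. 0) \<in> B \<and>
     (\<forall>f\<in>B. \<forall>g\<in>B. (\<lambda>x. f x + g x) \<in> B \<and> N (\<lambda>x. f x + g x) \<le> N f + N g) \<and>
     (\<forall>c. \<forall>f\<in>B. (\<lambda>x. c * f x) \<in> B \<and> N (\<lambda>x. c * f x) = \<bar>c\<bar> * N f) \<and>
     (\<forall>f\<in>B. 0 \<le> N f \<and> (N f = 0 \<longleftrightarrow> (AE x in M. f x = 0)))"

definition admissible_spaces ::
  "'a measure \<Rightarrow> real \<Rightarrow> ('a \<Rightarrow> real) set \<Rightarrow> (('a \<Rightarrow> real) \<Rightarrow> real) \<Rightarrow>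
     ('a \<Rightarrow> real) set \<Rightarrow> (('a \<Rightarrow> real) \<Rightarrow> real) \<Rightarrow> bool" where
  "admissible_spaces M C Bs Ns Bw Nw \<longleftrightarrow>
     normed_subspace_L1 M Bs Ns \<and> normed_subspace_L1 M Bw Nw \<and> Bs \<subseteq> Bw \<and>
     (\<forall>A\<in>sets M. indicat_real A \<in> Bw) \<and>
     1 \<le> C \<and> (\<forall>f\<in>Bs. \<forall>g\<in>Bs. (\<lambda>x. f x * g x) \<in> Bs \<and> Ns (\<lambda>x. f x * g x) \<le> C * Ns f * Ns g) \<and>
     (\<forall>f\<in>Bw. \<forall>e>0. \<exists>g\<in>Bs. Nw (\<lambda>x. f x - g x) < e) \<and>
     (\<forall>f\<in>Bw. (LINT x|M. \<bar>f x\<bar>) \<le> Nw f) \<and>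
     (\<forall>f\<in>Bs. Linf_enorm M f \<le> ereal (Ns f))"

end

theory Submission
  imports Defs
begin

text \<open>
  For \<open>g \<in> Bs\<close> the function \<open>f = g h - (\<integral>g d\<mu>) h\<close> lies in \<open>Bs\<close> and has mean zero, and since
  \<open>\<mu>\<close> is invariant, the covariance of \<open>g\<close> and \<open>\<psi> \<circ> F\<^sup>n\<close> under \<open>\<mu>\<close> is \<open>\<integral> (\<psi> \<circ> F\<^sup>n) f dm\<close>.
  Duality of composition and transfer (\<open>transfer_operator_duality\<close>) turns this into
  \<open>\<integral> \<psi> L\<^sup>n f dm\<close>, which is at most \<open>\<parallel>\<psi>\<parallel>\<^sub>\<infinity> \<parallel>L\<^sup>n f\<parallel>\<^sub>1 \<le> \<parallel>\<psi>\<parallel>\<^sub>\<infinity> \<Phi>(n) \<parallel>f\<parallel>\<^sub>s\<close>. The product estimate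
  in \<open>Bs\<close> gives \<open>\<parallel>f\<parallel>\<^sub>s \<le> C (\<parallel>h\<parallel>\<^sub>s + \<parallel>h\<parallel>\<^sub>s\<^sup>2) \<parallel>g\<parallel>\<^sub>s\<close>.

  Inserting this last bound requires \<open>\<Phi>(n) \<ge> 0\<close>, which must be derived. It holds as soon as \<open>Bs\<close>
  contains one mean-zero function of positive norm. If there were none, every element of \<open>Bs\<close>
  would be a multiple of \<open>h\<close> up to null sets, hence, \<open>Bs\<close> being dense in \<open>Bw\<close>, so would be the
  indicator function of every measurable set
  (\<open>indicator_multiple_of_density\<close>). That is absurd on a manifold, where a chart
  contains two disjoint sets of positive measure (\<open>normalized_lebesgue_disjoint_sets\<close>).
\<close>

section \<open>Essentially bounded functions\<close>

lemma Linf_enorm_bound_AE: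
  assumes "prob_space M" and "Linf_enorm M f \<le> ereal c"
  shows "AE x in M. \<bar>f x\<bar> \<le> c"
proof -
  have "AE x in M. ereal \<bar>f x\<bar> \<le> Linf_enorm M f"
    unfolding Linf_enorm_def by (rule esssup_AE)
  then show ?thesis
  proof eventually_elim
    case (elim x)
    then have "ereal \<bar>f x\<bar> \<le> ereal c"
      using assms(2) by (rule order_trans)
    then show ?case by simp
  qed
qed

lemma Linf_enorm_nonneg:
  assumes "prob_space M"
  shows "0 \<le> Linf_enorm M f"
proof -
  interpret prob_space M by fact
  have "AE x in M. ereal \<bar>f x\<bar> \<le> Linf_enorm M f"
    unfolding Linf_enorm_def by (rule esssup_AE)
  then have "AE x in M. 0 \<le> Linf_enorm M f"
    by eventually_elim (meson abs_ge_zero ereal_less_eq(5) order_trans)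
  then show ?thesis
    by simp
qed

lemma Linf_norm_nonneg:
  assumes "prob_space M"
  shows "0 \<le> Linf_norm M f"
  unfolding Linf_norm_def
  by (rule real_of_ereal_pos) (rule Linf_enorm_nonneg[OF assms])

text \<open>
  On a probability space the essential supremum of an absolute value is neither \<open>-\<infinity>\<close> nor, for
  members of \<open>Linf\<close>, \<open>\<infinity>\<close>; so its conversion to a real number loses nothing.
\<close>

lemma Linf_norm_bound_AE:
  assumes "prob_space M" and "f \<in> Linf M"
  shows "AE x in M. \<bar>f x\<bar> \<le> Linf_norm M f"
proof (rule Linf_enorm_bound_AE[OF assms(1)])
  have "\<bar>Linf_enorm M f\<bar> \<noteq> \<infinity>"
    using Linf_enorm_nonneg[OF assms(1), of f] assms(2) by (auto simp: Linf_def)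
  then show "Linf_enorm M f \<le> ereal (Linf_norm M f)"
    unfolding Linf_norm_def by (simp add: ereal_real')
qed

lemma integrable_mult_AE_bounded:
  fixes f p :: "'a \<Rightarrow> real"
  assumes f: "integrable M f" and p: "p \<in> borel_measurable M" "AE x in M. \<bar>p x\<bar> \<le> c"
  shows "integrable M (\<lambda>x. p x * f x)"
proof (rule Bochner_Integration.integrable_bound)
  show "integrable M (\<lambda>x. c * \<bar>f x\<bar>)"
    using f by auto
  show "(\<lambda>x. p x * f x) \<in> borel_measurable M"
    using f p(1) by measurable
  show "AE x in M. norm (p x * f x) \<le> norm (c * \<bar>f x\<bar>)"
    using p(2)
  proof eventually_elim
    case (elim x)
    then have "\<bar>p x\<bar> * \<bar>f x\<bar> \<le> \<bar>c\<bar> * \<bar>f x\<bar>"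
      by (intro mult_right_mono) auto
    then show ?case by (simp add: abs_mult)
  qed
qed

lemma abs_integral_mult_le:
  fixes f p :: "'a \<Rightarrow> real"
  assumes f: "integrable M f" and p: "p \<in> borel_measurable M" "AE x in M. \<bar>p x\<bar> \<le> c"
  shows "\<bar>LINT x|M. p x * f x\<bar> \<le> c * (LINT x|M. \<bar>f x\<bar>)"
proof -
  have int: "integrable M (\<lambda>x. p x * f x)"
    by (rule integrable_mult_AE_bounded[OF f p])
  have "\<bar>LINT x|M. p x * f x\<bar> \<le> (LINT x|M. \<bar>p x * f x\<bar>)"
    by (rule integral_abs_bound)
  also have "\<dots> \<le> (LINT x|M. c * \<bar>f x\<bar>)"
  proof (rule integral_mono_AE)
    show "integrable M (\<lambda>x. \<bar>p x * f x\<bar>)" "integrable M (\<lambda>x. c * \<bar>f x\<bar>)"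
      using int f by auto
    show "AE x in M. \<bar>p x * f x\<bar> \<le> c * \<bar>f x\<bar>"
      using p(2) by eventually_elim (simp add: abs_mult mult_right_mono)
  qed
  finally show ?thesis by simp
qed


section \<open>Duality of transfer and composition\<close>

lemma nonsingular_AE_comp:
  assumes ns: "nonsingular M F" and P: "AE x in M. P x"
  shows "AE x in M. P (F x)"
proof -
  obtain N where N: "N \<in> sets M" "emeasure M N = 0" "{x \<in> space M. \<not> P x} \<subseteq> N"
    using P by (auto elim!: AE_E)
  have meas: "F \<in> measurable M M"
    using ns by (simp add: nonsingular_def)
  have "emeasure M (F -` N \<inter> space M) = 0"
    using ns N by (simp add: nonsingular_def)
  moreover have "F -` N \<inter> space M \<in> sets M"
    using meas N(1) by (rule measurable_sets)
  moreover have "{x \<in> space M. \<not> P (F x)} \<subseteq> F -` N \<inter> space M"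
    using N(3) measurable_space[OF meas] by auto
  ultimately show ?thesis
    by (intro AE_I)
qed

text \<open>
  The defining property is the case of indicator functions. Linearity extends it to
  simple functions, and an essentially bounded \<open>p\<close> is a limit of simple functions dominated
  by \<open>2 \<bar>p\<bar>\<close>. Nonsingularity keeps the dominating bound for the composition with \<open>F\<close>.
\<close>

lemma transfer_operator_duality:
  fixes f p :: "'a \<Rightarrow> real"
  assumes ns: "nonsingular M F" and L: "transfer_operator M F L"
    and f: "integrable M f"
    and p: "p \<in> borel_measurable M" "AE x in M. \<bar>p x\<bar> \<le> c"
  shows "(LINT x|M. p x * L f x) = (LINT x|M. p (F x) * f x)"
proof -
  have F: "F \<in> measurable M M"
    using ns by (simp add: nonsingular_def)
  have Lf: "integrable M (L f)"
    using L f by (simp add: transfer_operator_def)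
  have indicator_case: "(LINT x|M. indicat_real A x * L f x) = (LINT x|M. indicat_real A (F x) * f x)"
    if A: "A \<in> sets M" for A
  proof -
    have "(LINT x|M. indicat_real A x * L f x) = (LINT x|M. indicat_real (F -` A \<inter> space M) x * f x)"
      using L f A by (simp add: transfer_operator_def set_lebesgue_integral_def)
    also have "\<dots> = (LINT x|M. indicat_real A (F x) * f x)"
      by (rule Bochner_Integration.integral_cong) (auto simp: indicator_def)
    finally show ?thesis .
  qed
  have simple_case: "(LINT x|M. s x * L f x) = (LINT x|M. s (F x) * f x)"
    if s: "simple_function M s" for s :: "'a \<Rightarrow> real"
  proof -
    define A where "A y = s -` {y} \<inter> space M" for y
    have A: "A y \<in> sets M" for y
      unfolding A_def using s by (rule simple_functionD(2))
    have rep: "s x = (\<Sum>y\<in>s ` space M. y * indicat_real (A y) x)" if "x \<in> space M" for x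
      unfolding A_def
      by (subst simple_function_indicator_representation_banach[OF s that]) (simp add: mult.commute)
    have int1: "integrable M (\<lambda>x. y * (indicat_real (A y) x * L f x))" for y
      using integrable_real_mult_indicator[OF A Lf, of y] by (simp add: mult.commute)
    have int2: "integrable M (\<lambda>x. y * (indicat_real (A y) (F x) * f x))" for y
    proof -
      have "(\<lambda>x. indicat_real (A y) (F x)) \<in> borel_measurable M"
        using F A[of y] by measurable
      then show ?thesis
        using integrable_mult_AE_bounded[OF f, of "\<lambda>x. indicat_real (A y) (F x)" 1]
        by (simp add: indicator_def)
    qed
    have "(LINT x|M. s x * L f x)
        = (LINT x|M. (\<Sum>y\<in>s ` space M. y * (indicat_real (A y) x * L f x)))"
      by (intro Bochner_Integration.integral_cong refl, subst rep)
        (simp_all add: sum_distrib_right mult.assoc)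
    also have "\<dots> = (\<Sum>y\<in>s ` space M. y * (LINT x|M. indicat_real (A y) x * L f x))"
      using int1 by (subst Bochner_Integration.integral_sum) auto
    also have "\<dots> = (\<Sum>y\<in>s ` space M. y * (LINT x|M. indicat_real (A y) (F x) * f x))"
      by (simp add: indicator_case A)
    also have "\<dots> = (LINT x|M. (\<Sum>y\<in>s ` space M. y * (indicat_real (A y) (F x) * f x)))"
      using int2 by (subst Bochner_Integration.integral_sum) auto
    also have "\<dots> = (LINT x|M. s (F x) * f x)"
      by (intro Bochner_Integration.integral_cong refl, subst rep[OF measurable_space[OF F]])
        (simp_all add: sum_distrib_right mult.assoc)
    finally show ?thesis .
  qed
  obtain S where S: "\<And>i. simple_function M (S i)"
      "\<And>x. x \<in> space M \<Longrightarrow> (\<lambda>i. S i x) \<longlonglongrightarrow> p x"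
      "\<And>i x. x \<in> space M \<Longrightarrow> dist (S i x) 0 \<le> 2 * dist (p x) 0"
    using borel_measurable_implies_sequence_metric[OF p(1), of 0] by blast
  have S_meas: "S i \<in> borel_measurable M" for i
    using S(1) by (rule borel_measurable_simple_function)
  have lim1: "(\<lambda>i. LINT x|M. S i x * L f x) \<longlonglongrightarrow> (LINT x|M. p x * L f x)"
  proof (rule integral_dominated_convergence[where w = "\<lambda>x. 2 * c * \<bar>L f x\<bar>"])
    show "(\<lambda>x. p x * L f x) \<in> borel_measurable M" "\<And>i. (\<lambda>x. S i x * L f x) \<in> borel_measurable M"
      using p(1) Lf S_meas by measurable
    show "integrable M (\<lambda>x. 2 * c * \<bar>L f x\<bar>)"
      using Lf by auto
    show "AE x in M. (\<lambda>i. S i x * L f x) \<longlonglongrightarrow> p x * L f x"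
      by (intro AE_I2 tendsto_mult tendsto_const S(2))
    show "AE x in M. norm (S i x * L f x) \<le> 2 * c * \<bar>L f x\<bar>" for i
      using p(2) AE_space
    proof eventually_elim
      case (elim x)
      then have "\<bar>S i x\<bar> \<le> 2 * c"
        using S(3)[of x i] by simp
      then show ?case by (simp add: abs_mult mult_right_mono)
    qed
  qed
  have lim2: "(\<lambda>i. LINT x|M. S i (F x) * f x) \<longlonglongrightarrow> (LINT x|M. p (F x) * f x)"
  proof (rule integral_dominated_convergence[where w = "\<lambda>x. 2 * c * \<bar>f x\<bar>"])
    show "(\<lambda>x. p (F x) * f x) \<in> borel_measurable M"
      "\<And>i. (\<lambda>x. S i (F x) * f x) \<in> borel_measurable M"
      using measurable_compose[OF F p(1)] measurable_compose[OF F S_meas] f by auto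
    show "integrable M (\<lambda>x. 2 * c * \<bar>f x\<bar>)"
      using f by auto
    show "AE x in M. (\<lambda>i. S i (F x) * f x) \<longlonglongrightarrow> p (F x) * f x"
      by (intro AE_I2 tendsto_mult tendsto_const S(2) measurable_space[OF F])
    show "AE x in M. norm (S i (F x) * f x) \<le> 2 * c * \<bar>f x\<bar>" for i
      using nonsingular_AE_comp[OF ns p(2)] AE_space
    proof eventually_elim
      case (elim x)
      then have "\<bar>S i (F x)\<bar> \<le> 2 * c"
        using S(3)[of "F x" i] measurable_space[OF F] by simp
      then show ?case by (simp add: abs_mult mult_right_mono)
    qed
  qed
  show ?thesis
    using LIMSEQ_unique[OF lim1] lim2 by (simp add: simple_case[OF S(1)])
qed

lemma nonsingular_funpow:
  assumes ns: "nonsingular M F"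
  shows "nonsingular M (F ^^ n)"
proof (induction n)
  case 0
  show ?case
    by (auto simp: nonsingular_def Int_absorb2 sets.sets_into_space)
next
  case (Suc n)
  have F: "F \<in> measurable M M" and Fn: "F ^^ n \<in> measurable M M"
    using ns Suc by (auto simp: nonsingular_def)
  have vimage: "(F ^^ Suc n) -` A \<inter> space M = (F ^^ n) -` (F -` A \<inter> space M) \<inter> space M" for A
    using measurable_space[OF Fn] by auto
  have "F ^^ Suc n \<in> measurable M M"
    unfolding funpow.simps using Fn F by (rule measurable_comp)
  then show ?case
    using ns Suc measurable_sets[OF F] by (simp add: nonsingular_def vimage del: funpow.simps vimage_Int)
qed

lemma transfer_operator_funpow:
  assumes ns: "nonsingular M F" and L: "transfer_operator M F L"
  shows "transfer_operator M (F ^^ n) (L ^^ n)"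
proof (induction n)
  case 0
  show ?case
    by (auto simp: transfer_operator_def Int_absorb2 sets.sets_into_space)
next
  case (Suc n)
  have F: "F \<in> measurable M M" and Fn: "F ^^ n \<in> measurable M M"
    using ns nonsingular_funpow[OF ns, of n] by (auto simp: nonsingular_def)
  have vimage: "(F ^^ Suc n) -` A \<inter> space M = (F ^^ n) -` (F -` A \<inter> space M) \<inter> space M" for A
    using measurable_space[OF Fn] by auto
  have "(L ^^ Suc n) f = L ((L ^^ n) f)" for f
    by simp
  then show ?case
    using L Suc measurable_sets[OF F]
    by (simp add: transfer_operator_def vimage del: funpow.simps vimage_Int)
qed

lemma invariant_prob_integral_funpow:
  fixes p :: "'a \<Rightarrow> real"
  assumes inv: "invariant_prob \<mu> F" and p: "p \<in> borel_measurable \<mu>"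
  shows "(LINT x|\<mu>. p ((F ^^ n) x)) = (LINT x|\<mu>. p x)"
  using p
proof (induction n arbitrary: p)
  case 0
  show ?case by simp
next
  case (Suc n)
  have F: "F \<in> measurable \<mu> \<mu>" and distr: "distr \<mu> \<mu> F = \<mu>"
    using inv by (auto simp: invariant_prob_def)
  have "(LINT x|\<mu>. p (F ((F ^^ n) x))) = (LINT x|\<mu>. p (F x))"
    using Suc.IH[OF measurable_compose[OF F Suc.prems]] .
  also have "\<dots> = (LINT x|distr \<mu> \<mu> F. p x)"
    by (rule integral_distr[OF F Suc.prems, symmetric])
  finally show ?case by (simp add: distr)
qed


section \<open>Normalized Lebesgue measures are not concentrated on an atom\<close>

text \<open>
  A point of the set may lie on the boundary of the orthant, where no ball around it fits; but
  the interior of the orthant is dense, so a nearby centre works.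
\<close>

lemma openin_orthant_contains_ball:
  fixes W :: "'e::euclidean_space set"
  assumes W: "openin (top_of_set orthant) W" and "W \<noteq> {}"
  obtains c r where "0 < r" "ball c r \<subseteq> W"
proof -
  obtain y where y: "y \<in> W"
    using \<open>W \<noteq> {}\<close> by blast
  obtain T where T: "open T" "W = orthant \<inter> T"
    using W by (auto simp: openin_open)
  obtain e where e: "0 < e" "ball y e \<subseteq> T"
    using T y by (metis IntD2 open_contains_ball)
  define v where "v = (\<Sum>i\<in>Basis. i :: 'e)"
  have v: "v \<bullet> i = 1" if "i \<in> Basis" for i
    unfolding v_def using that by (simp add: inner_sum_left_Basis)
  have "v \<noteq> 0"
    using v nonempty_Basis by (metis all_not_in_conv inner_zero_left zero_neq_one)
  define t where "t = e / (2 * norm v)"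
  have t: "0 < t" "t * norm v = e / 2"
    using e(1) \<open>v \<noteq> 0\<close> by (auto simp: t_def)
  \<comment> \<open>Moving \<open>y\<close> along the diagonal by \<open>t\<close> makes all its coordinates at least \<open>t\<close>.\<close>
  define c where "c = y + t *\<^sub>R v"
  have "ball c (min t (e / 2)) \<subseteq> W"
  proof
    fix z assume z: "z \<in> ball c (min t (e / 2))"
    have "dist y c = e / 2"
      using t by (simp add: c_def dist_norm)
    then have "dist y z < e"
      using z dist_triangle[of y z c] by simp
    then have "z \<in> T"
      using e(2) by (auto simp: mem_ball)
    moreover have "0 \<le> z \<bullet> i" if i: "i \<in> Basis" for i
    proof -
      have "\<bar>(c - z) \<bullet> i\<bar> \<le> norm (c - z)"
        using i by (rule Basis_le_norm)
      then have "\<bar>(c - z) \<bullet> i\<bar> < t"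
        using z by (simp add: dist_norm)
      moreover have "t \<le> c \<bullet> i"
        using y T(2) i by (simp add: c_def inner_add_left v orthant_def)
      ultimately show ?thesis
        by (simp add: inner_diff_left)
    qed
    ultimately show "z \<in> W"
      by (simp add: T(2) orthant_def)
  qed
  moreover have "0 < min t (e / 2)"
    using t(1) e(1) by simp
  ultimately show ?thesis
    by (rule that[rotated])
qed

text \<open>The density of \<open>M\<close> in a chart is strictly positive, so it charges whatever has volume.\<close>

lemma normalized_lebesgue_chart_ball:
  fixes \<phi> :: "'a \<Rightarrow> 'e::euclidean_space"
  assumes man: "is_manifold X \<A>" and leb: "normalized_lebesgue X \<A> M"
    and chart: "(U, \<phi>) \<in> \<A>" and ball: "ball c r \<subseteq> \<phi> ` U" and r: "0 < r"
  defines "V \<equiv> {x \<in> U. \<phi> x \<in> ball c r}"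
  shows "V \<in> sets M" and "0 < emeasure M V"
proof -
  have ch: "is_chart X U \<phi>"
    using man chart unfolding is_manifold_def by fast
  then have U: "openin X U" and hom: "homeomorphic_map (subtopology X U) (top_of_set (\<phi> ` U)) \<phi>"
    by (auto simp: is_chart_def)
  have top: "topspace (subtopology X U) = U"
    using openin_subset[OF U] by auto
  have "openin (top_of_set (\<phi> ` U)) (ball c r)"
    using ball by (intro openin_open_subtopology[THEN iffD2] open_subset) auto
  then have "openin (subtopology X U) V"
    using openin_continuous_map_preimage[OF homeomorphic_imp_continuous_map[OF hom]]
    unfolding V_def top by blast
  then have "openin X V"
    using U by (metis openin_trans_full)
  then show V: "V \<in> sets M"
    using leb openin_subset by (auto simp: normalized_lebesgue_def)
  have image: "\<phi> ` V = ball c r"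
    using ball by (auto simp: V_def)
  obtain \<rho> :: "'e \<Rightarrow> real" where \<rho>: "continuous_on (\<phi> ` U) \<rho>" "\<And>y. y \<in> \<phi> ` U \<Longrightarrow> 0 < \<rho> y"
      and em: "\<And>A. A \<in> sets M \<Longrightarrow> A \<subseteq> U \<Longrightarrow>
        emeasure M A = (\<integral>\<^sup>+ y. ennreal (\<rho> y) * indicator (\<phi> ` A) y \<partial>lborel)"
    using leb chart unfolding normalized_lebesgue_def by fast
  have "(\<lambda>y. indicator (ball c r) y *\<^sub>R \<rho> y) \<in> borel_measurable borel"
    using continuous_on_subset[OF \<rho>(1) ball] by (intro borel_measurable_continuous_on_indicator) auto
  then have "(\<lambda>y. ennreal (indicator (ball c r) y *\<^sub>R \<rho> y)) \<in> borel_measurable lborel"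
    by simp
  also have "(\<lambda>y. ennreal (indicator (ball c r) y *\<^sub>R \<rho> y))
      = (\<lambda>y. ennreal (\<rho> y) * indicator (ball c r) y)"
    by (auto simp: indicator_def)
  finally have meas: "(\<lambda>y. ennreal (\<rho> y) * indicator (ball c r) y) \<in> borel_measurable lborel" .
  have "emeasure M V \<noteq> 0"
  proof
    assume "emeasure M V = 0"
    then have "(\<integral>\<^sup>+ y. ennreal (\<rho> y) * indicator (ball c r) y \<partial>lborel) = 0"
      using em[OF V] image by (simp add: V_def)
    then have "AE y in lborel. ennreal (\<rho> y) * indicator (ball c r) y = 0"
      using nn_integral_0_iff_AE[OF meas] by simp
    then have "AE y in lborel. y \<notin> ball c r"
    proof eventually_elim
      case (elim y)
      then show ?case
        using \<rho>(2)[of y] ball by (auto simp: indicator_def split: if_splits)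
    qed
    then have "emeasure lborel (ball c r) = 0"
      by (subst (asm) AE_iff_measurable[where N = "ball c r"]) auto
    then show False
      using content_ball_pos[OF r, of c] by (simp add: measure_def)
  qed
  then show "0 < emeasure M V"
    by (simp add: zero_less_iff_neq_zero)
qed

lemma normalized_lebesgue_disjoint_sets:
  fixes \<A> :: "('a set \<times> ('a \<Rightarrow> 'e::euclidean_space)) set"
  assumes man: "is_manifold X \<A>" and leb: "normalized_lebesgue X \<A> M"
  obtains A B where "A \<in> sets M" "B \<in> sets M" "A \<inter> B = {}" "0 < emeasure M A" "0 < emeasure M B"
proof -
  interpret prob_space M
    using leb by (simp add: normalized_lebesgue_def)
  have "space M = topspace X"
    using leb by (simp add: normalized_lebesgue_def)
  then obtain x where "x \<in> topspace X"
    using not_empty by blast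
  moreover have "\<Union>(fst ` \<A>) = topspace X"
    using man by (simp add: is_manifold_def)
  ultimately have "x \<in> \<Union>(fst ` \<A>)"
    by simp
  then obtain U \<phi> where chart: "(U, \<phi>) \<in> \<A>" and "x \<in> U"
    by auto
  then have "U \<noteq> {}"
    by blast
  have "is_chart X U \<phi>"
    using man chart unfolding is_manifold_def by fast
  then have W: "openin (top_of_set orthant) (\<phi> ` U)" "\<phi> ` U \<noteq> {}"
    using \<open>U \<noteq> {}\<close> by (simp_all add: is_chart_def)
  obtain c r where r: "0 < r" and ball: "ball c r \<subseteq> \<phi> ` U"
    using openin_orthant_contains_ball[OF W] by blast
  obtain b :: 'e where b: "b \<in> Basis"
    using nonempty_Basis by blast
  \<comment> \<open>The centres are at distance \<open>r / 2\<close>, the sum of the radii.\<close>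
  define c' where "c' = c + (r / 2) *\<^sub>R b"
  have dist: "dist c c' = r / 2"
    using b r by (simp add: c'_def dist_norm)
  have balls: "ball c (r / 4) \<subseteq> \<phi> ` U" "ball c' (r / 4) \<subseteq> \<phi> ` U"
  proof -
    show "ball c (r / 4) \<subseteq> \<phi> ` U"
      using ball r by (auto simp: subset_eq)
    have "ball c' (r / 4) \<subseteq> ball c r"
    proof
      fix z assume "z \<in> ball c' (r / 4)"
      then show "z \<in> ball c r"
        using dist_triangle[of c z c'] dist r by simp
    qed
    then show "ball c' (r / 4) \<subseteq> \<phi> ` U"
      using ball by blast
  qed
  have r4: "0 < r / 4"
    using r by simp
  have disjoint: "ball c (r / 4) \<inter> ball c' (r / 4) = {}"
  proof -
    have "\<not> (dist c z < r / 4 \<and> dist c' z < r / 4)" for z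
      using dist_triangle[of c c' z] dist by (simp add: dist_commute)
    then show ?thesis by auto
  qed
  note V = normalized_lebesgue_chart_ball[OF man leb chart balls(1) r4]
    and V' = normalized_lebesgue_chart_ball[OF man leb chart balls(2) r4]
  have "{x \<in> U. \<phi> x \<in> ball c (r / 4)} \<inter> {x \<in> U. \<phi> x \<in> ball c' (r / 4)} = {}"
    using disjoint by blast
  then show ?thesis
    by (rule that[OF V(1) V'(1) _ V(2) V'(2)])
qed


section \<open>Mean-zero functions in the strong space\<close>

lemma normed_subspace_L1D:
  assumes "normed_subspace_L1 M B N" and "f \<in> B"
  shows "integrable M f"
    and "g \<in> B \<Longrightarrow> (\<lambda>x. f x + g x) \<in> B"
    and "g \<in> B \<Longrightarrow> N (\<lambda>x. f x + g x) \<le> N f + N g"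
    and "(\<lambda>x. c * f x) \<in> B"
    and "N (\<lambda>x. c * f x) = \<bar>c\<bar> * N f"
    and "0 \<le> N f"
    and "N f = 0 \<Longrightarrow> AE x in M. f x = 0"
  using assms unfolding normed_subspace_L1_def by (elim conjE, blast)+

lemma admissible_spacesD:
  assumes "admissible_spaces M C Bs Ns Bw Nw"
  shows "normed_subspace_L1 M Bs Ns" and "normed_subspace_L1 M Bw Nw" and "Bs \<subseteq> Bw"
    and "A \<in> sets M \<Longrightarrow> indicat_real A \<in> Bw"
    and "1 \<le> C"
    and "f \<in> Bs \<Longrightarrow> g \<in> Bs \<Longrightarrow> (\<lambda>x. f x * g x) \<in> Bs"
    and "f \<in> Bs \<Longrightarrow> g \<in> Bs \<Longrightarrow> Ns (\<lambda>x. f x * g x) \<le> C * Ns f * Ns g"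
    and "f \<in> Bw \<Longrightarrow> 0 < e \<Longrightarrow> \<exists>g\<in>Bs. Nw (\<lambda>x. f x - g x) < e"
    and "f \<in> Bw \<Longrightarrow> (LINT x|M. \<bar>f x\<bar>) \<le> Nw f"
    and "f \<in> Bs \<Longrightarrow> Linf_enorm M f \<le> ereal (Ns f)"
  using assms unfolding admissible_spaces_def by (elim conjE, blast)+

lemma normed_subspace_L1_diff_scaled:
  assumes B: "normed_subspace_L1 M B N" and f: "f \<in> B" and g: "g \<in> B"
  shows "(\<lambda>x. f x - c * g x) \<in> B" and "N (\<lambda>x. f x - c * g x) \<le> N f + \<bar>c\<bar> * N g"
proof -
  note scaled = normed_subspace_L1D(4,5)[OF B g, of "- c"]
  show "(\<lambda>x. f x - c * g x) \<in> B" "N (\<lambda>x. f x - c * g x) \<le> N f + \<bar>c\<bar> * N g"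
    using normed_subspace_L1D(2,3)[OF B f scaled(1)] scaled(2) by simp_all
qed

text \<open>
  If the mean-zero part of \<open>Bs\<close> is trivial, then \<open>f = (\<integral>f) h\<close> almost everywhere for all \<open>f \<in> Bs\<close>.
  This identity is closed under \<open>L\<^sup>1\<close> limits, and the indicator functions are such limits.
\<close>

lemma indicator_multiple_of_density:
  assumes M: "prob_space M" and adm: "admissible_spaces M C Bs Ns Bw Nw"
    and h: "h \<in> Bs" "AE x in M. 0 \<le> h x" "(LINT x|M. h x) = 1"
    and trivial: "\<And>f. f \<in> Bs \<Longrightarrow> (LINT x|M. f x) = 0 \<Longrightarrow> Ns f = 0"
    and A: "A \<in> sets M"
  shows "AE x in M. indicat_real A x = measure M A * h x"
proof -
  interpret prob_space M by fact
  let ?d = "LINT x|M. \<bar>indicat_real A x - measure M A * h x\<bar>"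
  have A_int: "integrable M (indicat_real A)"
    using A by (simp add: emeasure_eq_measure)
  note Bs = admissible_spacesD(1)[OF adm] and Bw = admissible_spacesD(2)[OF adm]
    and sub = admissible_spacesD(3)[OF adm] and A_Bw = admissible_spacesD(4)[OF adm A]
  have h_int: "integrable M h"
    by (rule normed_subspace_L1D(1)[OF Bs h(1)])
  have "?d \<le> 0 + e" if e: "0 < e" for e
  proof -
    have "0 < e / 2"
      using e by simp
    then obtain g where g: "g \<in> Bs" "Nw (\<lambda>x. indicat_real A x - g x) < e / 2"
      using admissible_spacesD(8)[OF adm A_Bw] by blast
    have g_int: "integrable M g"
      by (rule normed_subspace_L1D(1)[OF Bs g(1)])
    define a where "a = (LINT x|M. g x)"
    have "(LINT x|M. g x - a * h x) = 0"
      using g_int h_int h(3) by (simp add: a_def)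
    then have "Ns (\<lambda>x. g x - a * h x) = 0"
      using trivial normed_subspace_L1_diff_scaled(1)[OF Bs g(1) h(1)] by blast
    then have g_eq: "AE x in M. g x - a * h x = 0"
      by (rule normed_subspace_L1D(7)[OF Bs normed_subspace_L1_diff_scaled(1)[OF Bs g(1) h(1)]])
    have "(\<lambda>x. indicat_real A x - g x) \<in> Bw"
      using normed_subspace_L1_diff_scaled(1)[OF Bw A_Bw, of g 1] g(1) sub by auto
    then have close: "(LINT x|M. \<bar>indicat_real A x - g x\<bar>) < e / 2"
      using admissible_spacesD(9)[OF adm] g(2) by (meson le_less_trans)
    have "measure M A - a = (LINT x|M. indicat_real A x - g x)"
      using A A_int g_int by (simp add: a_def)
    also have "\<bar>\<dots>\<bar> \<le> (LINT x|M. \<bar>indicat_real A x - g x\<bar>)"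
      by (rule integral_abs_bound)
    finally have mean: "\<bar>measure M A - a\<bar> < e / 2"
      using close by simp
    have "?d \<le> (LINT x|M. \<bar>indicat_real A x - g x\<bar> + \<bar>measure M A - a\<bar> * h x)"
    proof (rule integral_mono_AE)
      show "integrable M (\<lambda>x. \<bar>indicat_real A x - measure M A * h x\<bar>)"
        "integrable M (\<lambda>x. \<bar>indicat_real A x - g x\<bar> + \<bar>measure M A - a\<bar> * h x)"
        using A_int h_int g_int by auto
      show "AE x in M. \<bar>indicat_real A x - measure M A * h x\<bar>
          \<le> \<bar>indicat_real A x - g x\<bar> + \<bar>measure M A - a\<bar> * h x"
        using g_eq h(2)
      proof eventually_elim
        case (elim x)
        have "indicat_real A x - measure M A * h x
            = (indicat_real A x - g x) - (measure M A - a) * h x"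
          using elim(1) by (simp add: algebra_simps)
        also have "\<bar>\<dots>\<bar> \<le> \<bar>indicat_real A x - g x\<bar> + \<bar>(measure M A - a) * h x\<bar>"
          by (rule abs_triangle_ineq4)
        finally show ?case
          using elim(2) by (simp add: abs_mult)
      qed
    qed
    also have "\<dots> = (LINT x|M. \<bar>indicat_real A x - g x\<bar>) + \<bar>measure M A - a\<bar>"
      using A_int h_int g_int h(3) by simp
    finally show ?thesis
      using close mean by simp
  qed
  then have "?d \<le> 0"
    by (rule field_le_epsilon)
  moreover have "0 \<le> ?d"
    by simp
  ultimately have "?d = 0"
    by (rule antisym)
  then show ?thesis
    using A_int h_int by (subst (asm) integral_nonneg_eq_0_iff_AE) auto
qed

text \<open>
  Otherwise the indicator functions of two disjoint sets of positive measure would both be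
  nonzero multiples of \<open>h\<close>, hence proportional to each other.
\<close>

lemma exists_mean_zero_of_positive_norm:
  fixes \<A> :: "('a set \<times> ('a \<Rightarrow> 'e::euclidean_space)) set"
  assumes man: "is_manifold X \<A>" and leb: "normalized_lebesgue X \<A> M"
    and adm: "admissible_spaces M C Bs Ns Bw Nw"
    and h: "h \<in> Bs" "AE x in M. 0 \<le> h x" "(LINT x|M. h x) = 1"
  obtains f where "f \<in> Bs" "(LINT x|M. f x) = 0" "0 < Ns f"
proof -
  have M: "prob_space M"
    using leb by (simp add: normalized_lebesgue_def)
  interpret prob_space M by fact
  have nonneg: "0 \<le> Ns f" if "f \<in> Bs" for f
    by (rule normed_subspace_L1D(6)[OF admissible_spacesD(1)[OF adm] that])
  have "\<exists>f\<in>Bs. (LINT x|M. f x) = 0 \<and> Ns f \<noteq> 0"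
  proof (rule ccontr)
    assume "\<not> ?thesis"
    then have trivial: "\<And>f. f \<in> Bs \<Longrightarrow> (LINT x|M. f x) = 0 \<Longrightarrow> Ns f = 0"
      by blast
    obtain A B where AB: "A \<in> sets M" "B \<in> sets M" "A \<inter> B = {}"
      and pos: "0 < emeasure M A" "0 < emeasure M B"
      using normalized_lebesgue_disjoint_sets[OF man leb] by blast
    have "measure M A \<noteq> 0" "measure M B \<noteq> 0"
      using pos by (auto simp: emeasure_eq_measure)
    have multiple: "AE x in M. indicat_real D x = measure M D * h x" if "D \<in> sets M" for D
      using indicator_multiple_of_density[OF M adm h _ that] trivial by blast
    \<comment> \<open>At a point of \<open>A\<close>, the identity for \<open>A\<close> makes \<open>h\<close> nonzero and the one for \<open>B\<close> makes it zero.\<close>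
    have "AE x in M. x \<notin> A"
      using multiple[OF AB(1)] multiple[OF AB(2)]
    proof eventually_elim
      case (elim x)
      then show ?case
        using AB(3) \<open>measure M B \<noteq> 0\<close> by (cases "x \<in> A") (auto simp: disjoint_iff)
    qed
    then have "emeasure M A = 0"
      using AB(1) sets.sets_into_space[OF AB(1)]
      by (subst (asm) AE_iff_measurable[where N = A]) auto
    then show False
      using pos(1) by simp
  qed
  then show ?thesis
    using nonneg that by (metis less_eq_real_def)
qed


section \<open>Decay of correlations\<close>

text \<open>Since \<open>M\<close> has total mass one, \<open>\<bar>\<integral>f\<bar> \<le> \<parallel>f\<parallel>\<^sub>\<infinity> \<le> \<parallel>f\<parallel>\<^sub>s\<close>.\<close>

lemma abs_integral_le_strong_norm:
  assumes M: "prob_space M" and adm: "admissible_spaces M C Bs Ns Bw Nw" and f: "f \<in> Bs"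
  shows "\<bar>LINT x|M. f x\<bar> \<le> Ns f"
proof -
  interpret prob_space M by fact
  have f_int: "integrable M f"
    by (rule normed_subspace_L1D(1)[OF admissible_spacesD(1)[OF adm] f])
  have "AE x in M. \<bar>f x\<bar> \<le> Ns f"
    by (rule Linf_enorm_bound_AE[OF M admissible_spacesD(10)[OF adm f]])
  then have "\<bar>LINT x|M. f x * 1\<bar> \<le> Ns f * (LINT x|M. \<bar>1\<bar>)"
    using f_int by (intro abs_integral_mult_le) auto
  then show ?thesis
    by (simp add: prob_space)
qed

theorem lemma27:
  fixes X :: "'a topology"
    and \<A> :: "('a set \<times> ('a \<Rightarrow> 'e::euclidean_space)) set"
    and m :: "'a measure"
    and F :: "'a \<Rightarrow> 'a"
    and L :: "('a \<Rightarrow> real) \<Rightarrow> 'a \<Rightarrow> real"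
    and Bs Bw :: "('a \<Rightarrow> real) set"
    and Ns Nw :: "('a \<Rightarrow> real) \<Rightarrow> real"
    and C :: real
    and h :: "'a \<Rightarrow> real"
    and \<mu> :: "'a measure"
    and \<Phi> :: "nat \<Rightarrow> real"
  assumes "is_manifold X \<A>" and "normalized_lebesgue X \<A> m"
    and "nonsingular m F" and "transfer_operator m F L"
    and "admissible_spaces m C Bs Ns Bw Nw"
    and "\<And>f. f \<in> Bs \<Longrightarrow> L f \<in> Bs" and "\<And>f. f \<in> Bw \<Longrightarrow> L f \<in> Bw"
    and "h \<in> Bs" and "AE x in m. 0 \<le> h x"
    and "\<mu> = density m (\<lambda>x. ennreal (h x))" and "invariant_prob \<mu> F"
    and "\<Phi> \<longlonglongrightarrow> 0"
    and "\<And>f n. f \<in> Bs \<Longrightarrow> (LINT x|m. f x) = 0 \<Longrightarrow> Nw ((L ^^ n) f) \<le> \<Phi> n * Ns f"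
  shows "\<forall>\<psi>\<in>Linf m. \<forall>g\<in>Bs. \<forall>n.
    \<bar>(LINT x|\<mu>. g x * \<psi> ((F ^^ n) x)) - (LINT x|\<mu>. \<psi> x) * (LINT x|\<mu>. g x)\<bar>
      \<le> 2 * C * (Ns h + (Ns h)\<^sup>2) * \<Phi> n * Linf_norm m \<psi> * Ns g"
proof (intro ballI allI)
  fix \<psi> g :: "'a \<Rightarrow> real" and n :: nat
  assume \<psi>: "\<psi> \<in> Linf m" and g: "g \<in> Bs"
  note man = assms(1) and leb = assms(2) and ns = assms(3) and L = assms(4) and adm = assms(5)
    and L_Bw = assms(7) and h = assms(8,9) and \<mu> = assms(10) and inv = assms(11)
    and decay = assms(13)
  have m: "prob_space m"
    using leb by (simp add: normalized_lebesgue_def)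
  note Bs = admissible_spacesD(1)[OF adm] and sub = admissible_spacesD(3)[OF adm]
    and C = admissible_spacesD(5)[OF adm] and weak = admissible_spacesD(9)[OF adm]
  note Ns_nonneg = normed_subspace_L1D(6)[OF Bs]
  have h_int: "integrable m h" and g_int: "integrable m g"
    by (rule normed_subspace_L1D(1)[OF Bs h(1)] normed_subspace_L1D(1)[OF Bs g])+
  have \<psi>_meas: "\<psi> \<in> borel_measurable m"
    using \<psi> by (simp add: Linf_def)
  have \<psi>_bound: "AE x in m. \<bar>\<psi> x\<bar> \<le> Linf_norm m \<psi>"
    using Linf_norm_bound_AE[OF m \<psi>] .
  have nsn: "nonsingular m (F ^^ n)" and Ln: "transfer_operator m (F ^^ n) (L ^^ n)"
    using nonsingular_funpow[OF ns] transfer_operator_funpow[OF ns L] by blast+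
  have \<psi>n_meas: "(\<lambda>x. \<psi> ((F ^^ n) x)) \<in> borel_measurable m"
    using nsn \<psi>_meas by (auto simp: nonsingular_def intro: measurable_compose)
  have \<psi>n_bound: "AE x in m. \<bar>\<psi> ((F ^^ n) x)\<bar> \<le> Linf_norm m \<psi>"
    using nonsingular_AE_comp[OF nsn \<psi>_bound] .

  have to_m: "(LINT x|\<mu>. u x) = (LINT x|m. h x * u x)" if "u \<in> borel_measurable m" for u
    unfolding \<mu> using that h(2) h_int by (subst integral_density) auto
  have "prob_space \<mu>"
    using inv by (simp add: invariant_prob_def)
  then have "(LINT x|\<mu>. 1) = (1::real)"
    by (simp add: prob_space.prob_space)
  then have h_mean: "(LINT x|m. h x) = 1"
    using to_m[of "\<lambda>_. 1"] by simp

  have Ln_Bw: "(L ^^ n) u \<in> Bw" if "u \<in> Bs" for u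
    using that sub L_Bw by (induction n) auto
  \<comment> \<open>The sign of \<open>\<Phi> n\<close> is read off from one mean-zero function of positive norm.\<close>
  obtain u where u: "u \<in> Bs" "(LINT x|m. u x) = 0" "0 < Ns u"
    using exists_mean_zero_of_positive_norm[OF man leb adm h h_mean] by blast
  have "0 \<le> (LINT x|m. \<bar>(L ^^ n) u x\<bar>)"
    by simp
  then have "0 \<le> \<Phi> n * Ns u"
    using weak[OF Ln_Bw[OF u(1)]] decay[OF u(1,2), of n] by linarith
  then have \<Phi>_nonneg: "0 \<le> \<Phi> n"
    using u(3) by (simp add: zero_le_mult_iff)

  \<comment> \<open>Subtracting a multiple of \<open>h\<close>, which has mean one, centres \<open>g h\<close> without leaving \<open>Bs\<close>.\<close>
  define a where "a = (LINT x|m. g x * h x)"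
  define f where "f x = g x * h x - a * h x" for x
  have gh: "(\<lambda>x. g x * h x) \<in> Bs"
    by (rule admissible_spacesD(6)[OF adm g h(1)])
  have f_Bs: "f \<in> Bs" and f_norm: "Ns f \<le> Ns (\<lambda>x. g x * h x) + \<bar>a\<bar> * Ns h"
    using normed_subspace_L1_diff_scaled[OF Bs gh h(1), of a] by (simp_all add: f_def[abs_def])
  have gh_int: "integrable m (\<lambda>x. g x * h x)" and f_int: "integrable m f"
    by (rule normed_subspace_L1D(1)[OF Bs gh] normed_subspace_L1D(1)[OF Bs f_Bs])+
  have f_mean: "(LINT x|m. f x) = 0"
    using gh_int h_int h_mean by (simp add: f_def a_def)
  have f_norm': "Ns f \<le> C * (Ns h + (Ns h)\<^sup>2) * Ns g"
  proof -
    have gh_norm: "Ns (\<lambda>x. g x * h x) \<le> C * Ns g * Ns h"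
      by (rule admissible_spacesD(7)[OF adm g h(1)])
    have "\<bar>a\<bar> \<le> C * Ns g * Ns h"
      using abs_integral_le_strong_norm[OF m adm gh] gh_norm by (simp add: a_def)
    then have "\<bar>a\<bar> * Ns h \<le> C * Ns g * Ns h * Ns h"
      using Ns_nonneg[OF h(1)] by (rule mult_right_mono)
    then show ?thesis
      using f_norm gh_norm by (simp add: algebra_simps power2_eq_square)
  qed

  have "(LINT x|\<mu>. g x * \<psi> ((F ^^ n) x)) - (LINT x|\<mu>. \<psi> x) * (LINT x|\<mu>. g x)
      = (LINT x|m. \<psi> ((F ^^ n) x) * f x)"
  proof -
    have "(LINT x|\<mu>. \<psi> x) = (LINT x|\<mu>. \<psi> ((F ^^ n) x))"
      using inv \<psi>_meas by (intro invariant_prob_integral_funpow[symmetric]) (auto simp: \<mu>)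
    also have "\<dots> = (LINT x|m. \<psi> ((F ^^ n) x) * h x)"
      by (simp add: to_m[OF \<psi>n_meas] mult.commute)
    finally have \<psi>_mean: "(LINT x|\<mu>. \<psi> x) = (LINT x|m. \<psi> ((F ^^ n) x) * h x)" .
    have g_mean: "(LINT x|\<mu>. g x) = a"
      using g_int by (simp add: to_m a_def mult.commute)
    have "(LINT x|\<mu>. g x * \<psi> ((F ^^ n) x)) = (LINT x|m. \<psi> ((F ^^ n) x) * (g x * h x))"
      using g_int \<psi>n_meas by (subst to_m) (auto simp: ac_simps)
    moreover have "(LINT x|m. \<psi> ((F ^^ n) x) * f x) =
        (LINT x|m. \<psi> ((F ^^ n) x) * (g x * h x) - a * (\<psi> ((F ^^ n) x) * h x))"
      by (simp add: f_def algebra_simps)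
    moreover have "\<dots> = (LINT x|m. \<psi> ((F ^^ n) x) * (g x * h x))
        - a * (LINT x|m. \<psi> ((F ^^ n) x) * h x)"
      using integrable_mult_AE_bounded[OF gh_int \<psi>n_meas \<psi>n_bound]
        integrable_mult_AE_bounded[OF h_int \<psi>n_meas \<psi>n_bound] by simp
    ultimately show ?thesis
      by (simp add: \<psi>_mean g_mean mult.commute)
  qed
  also have "\<dots> = (LINT x|m. \<psi> x * (L ^^ n) f x)"
    by (rule transfer_operator_duality[OF nsn Ln f_int \<psi>_meas \<psi>_bound, symmetric])
  also have "\<bar>\<dots>\<bar> \<le> Linf_norm m \<psi> * (LINT x|m. \<bar>(L ^^ n) f x\<bar>)"
    using Ln f_int by (intro abs_integral_mult_le[OF _ \<psi>_meas \<psi>_bound])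
      (simp add: transfer_operator_def)
  also have "\<dots> \<le> Linf_norm m \<psi> * (\<Phi> n * Ns f)"
  proof (rule mult_left_mono)
    show "0 \<le> Linf_norm m \<psi>"
      by (rule Linf_norm_nonneg[OF m])
    show "(LINT x|m. \<bar>(L ^^ n) f x\<bar>) \<le> \<Phi> n * Ns f"
      using weak[OF Ln_Bw[OF f_Bs]] decay[OF f_Bs f_mean, of n] by linarith
  qed
  also have "\<dots> \<le> Linf_norm m \<psi> * (\<Phi> n * (2 * C * (Ns h + (Ns h)\<^sup>2) * Ns g))"
  proof -
    have "0 \<le> C * (Ns h + (Ns h)\<^sup>2) * Ns g"
      using C Ns_nonneg[OF h(1)] Ns_nonneg[OF g] by simp
    then have "Ns f \<le> 2 * C * (Ns h + (Ns h)\<^sup>2) * Ns g"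
      using f_norm' by linarith
    then show ?thesis
      using \<Phi>_nonneg Linf_norm_nonneg[OF m] by (intro mult_left_mono)
  qed
  finally show "\<bar>(LINT x|\<mu>. g x * \<psi> ((F ^^ n) x)) - (LINT x|\<mu>. \<psi> x) * (LINT x|\<mu>. g x)\<bar>
      \<le> 2 * C * (Ns h + (Ns h)\<^sup>2) * \<Phi> n * Linf_norm m \<psi> * Ns g"
    by (simp add: ac_simps)
qed

end
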